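(* Let $(X,\kappa)$ be a digital image. Then: (1) For subsets $A,W\subset X$ such that there is a positive integer $i$ with $Cl_\kappa^i(W)\subset Int_\kappa^i(A)$, the inclusion $(X-W,A-W)\to(X,A)$ induces isomorphisms $dH_n(X-W,A-W)\to dH_n(X,A)$ for all integers $n<i+1$. Equivalently, (2) For subsets $A,B\subset X$ such that there is a positive integer $i$ with $X=Int_\kappa^i(A)\cup Int_\kappa^i(B)$, the inclusion $(B,A\cap B)\to(X,A)$ induces isomorphisms $dH_n(B,A\cap B)\to dH_n(X,A)$ for all integers $n<i+1$.
   Context: A digital image $(X,\kappa)$ is a finite subset $X\subset\mathbb{Z}^d$ ($d\ge 1$) equipped with an adjacency relation $\kappa=c_l$ for some $1\le l\le d$, where distinct points $p,q\in\mathbb{Z}^d$ are $c_l$-adjacent if at most $l$ of their coordinates differ by one unit and all remaining coordinates are equal. Subsets of $X$ are digital images with the same adjacency. A function $f:(X,\kappa)\to(Y,\lambda)$ is $(\kappa,\lambda)$-continuous if whenever $x_0,x_1$ are $\kappa$-adjacent, $f(x_0),f(x_1)$ are equal or $\lambda$-adjacent. $\kappa$-interior and $\kappa$-closure in $X$. For $x\in X$, $N_\kappa(x,X)=\{y\in X: y=x\text{ or }y\text{ is }\kappa\text{-adjacent to }x\}$. For $A\subset X$, $Int_\kappa(A)=\{x\in A: N_\kappa(x,X)\subset A\}$ and $Cl_\kappa(A)=\{x\in X: N_\kappa(x,X)\cap A\ne\emptyset\}$. Set $Int_\kappa^0(A)=Cl_\kappa^0(A)=A$, $Int_\kappa^i(A)=Int_\kappa(Int_\kappa^{i-1}(A))$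 and $Cl_\kappa^i(A)=Cl_\kappa(Cl_\kappa^{i-1}(A))$ for $i\ge1$. Cubical singular homology. $I=\{0,1\}\subset\mathbb{Z}$, and $I^n$ carries the $c_1$-adjacency of $\mathbb{Z}^n$ (denoted $2n$); $I^0$ is a point. A digital $n$-cube in $(X,\kappa)$ is a $(2n,\kappa)$-continuous map $T:I^n\to X$; it is degenerate if for some $i$, $T(t_1,\dots,t_n)$ does not depend on $t_i$. $dQ_n(X)$ is the free abelian group on digital $n$-cubes, $dD_n(X)$ the subgroup generated by degenerate ones, $dC_n(X)=dQ_n(X)/dD_n(X)$ (zero for $n<0$). Put $A_iT(t_1,\dots,t_{n-1})=T(t_1,\dots,t_{i-1},0,t_i,\dots,t_{n-1})$, $B_iT(t_1,\dots,t_{n-1})=T(t_1,\dots,t_{i-1},1,t_i,\dots,t_{n-1})$, $\partial_n T=\sum_{i=1}^n(-1)^i(A_iT-B_iT)$ (with $\partial_n=0$ for $n\le0$); this induces a boundary map on $dC_\bullet(X)$ with $\partial\partial=0$. For $A\subset X$, $dC_n(A)$ is a subgroup of $dC_n(X)$ preserved by $\partial$; put $dC_n(X,A)=dC_n(X)/dC_n(A)$ with the induced boundary, and let $dH_n(X,A)$ be the $n$-th homology group of $(dC_\bullet(X,A),\partial)$. A map of pairs $f:(X,A)\to(Y,B)$ (continuous, with $f(A)\subset B$) induces $f_*:dH_n(X,A)\to dH_n(Y,B)$ via $T\mapsto f\circ T$. *)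

theory Defs
  imports "HOL-Algebra.Free_Abelian_Groups" "HOL-Algebra.Generated_Groups"
begin

section \<open>Digital images\<close>

text \<open>A point of \<open>\<int>\<^sup>d\<close> is an integer list of length \<open>d\<close>; this covers both the ambient
  space of the image and the cubes \<open>I\<^sup>n\<close>, for varying \<open>n\<close>.\<close>

definition c_adj :: "nat \<Rightarrow> int list \<Rightarrow> int list \<Rightarrow> bool" where
  "c_adj l p q \<longleftrightarrow> length p = length q \<and> p \<noteq> q \<and>
     card {i. i < length p \<and> p ! i \<noteq> q ! i} \<le> l \<and>
     (\<forall>i < length p. p ! i \<noteq> q ! i \<longrightarrow> \<bar>p ! i - q ! i\<bar> = 1)"

definition digital_image :: "nat \<Rightarrow> nat \<Rightarrow> int list set \<Rightarrow> bool" where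
  "digital_image d l X \<longleftrightarrow>
     1 \<le> d \<and> 1 \<le> l \<and> l \<le> d \<and> finite X \<and> (\<forall>p \<in> X. length p = d)"

text \<open>From here on a space is a set of points of an arbitrary type together with an adjacency
  relation; a subset carries the same relation.\<close>

definition dcontinuous ::
  "('a \<Rightarrow> 'a \<Rightarrow> bool) \<Rightarrow> 'a set \<Rightarrow> ('b \<Rightarrow> 'b \<Rightarrow> bool) \<Rightarrow> 'b set \<Rightarrow> ('a \<Rightarrow> 'b) \<Rightarrow> bool" where
  "dcontinuous \<kappa> X \<mu> Y f \<longleftrightarrow>
     f \<in> X \<rightarrow> Y \<and> (\<forall>x \<in> X. \<forall>y \<in> X. \<kappa> x y \<longrightarrow> f x = f y \<or> \<mu> (f x) (f y))"

definition nbhd :: "('a \<Rightarrow> 'a \<Rightarrow> bool) \<Rightarrow> 'a set \<Rightarrow> 'a \<Rightarrow> 'a set" where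
  "nbhd \<kappa> X x = {y \<in> X. y = x \<or> \<kappa> y x}"

definition dInt :: "('a \<Rightarrow> 'a \<Rightarrow> bool) \<Rightarrow> 'a set \<Rightarrow> 'a set \<Rightarrow> 'a set" where
  "dInt \<kappa> X A = {x \<in> A. nbhd \<kappa> X x \<subseteq> A}"

definition dCl :: "('a \<Rightarrow> 'a \<Rightarrow> bool) \<Rightarrow> 'a set \<Rightarrow> 'a set \<Rightarrow> 'a set" where
  "dCl \<kappa> X A = {x \<in> X. nbhd \<kappa> X x \<inter> A \<noteq> {}}"

section \<open>Cubical chains\<close>

definition unit_cube :: "nat \<Rightarrow> int list set" where
  "unit_cube n = {t. length t = n \<and> set t \<subseteq> {0, 1}}"

text \<open>Cubes are extensional, so that they are equal iff they agree on \<open>I\<^sup>n\<close>. The dimension is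
  an integer, with no cubes in negative dimensions; hence all groups below are trivial
  there.\<close>

definition dcubes :: "('a \<Rightarrow> 'a \<Rightarrow> bool) \<Rightarrow> 'a set \<Rightarrow> int \<Rightarrow> (int list \<Rightarrow> 'a) set" where
  "dcubes \<kappa> X n = (if n < 0 then {} else
     {T \<in> extensional (unit_cube (nat n)). dcontinuous (c_adj 1) (unit_cube (nat n)) \<kappa> X T})"

definition degenerate :: "int \<Rightarrow> (int list \<Rightarrow> 'a) \<Rightarrow> bool" where
  "degenerate n T \<longleftrightarrow> (\<exists>i < nat n. \<forall>s \<in> unit_cube (nat n). \<forall>t \<in> unit_cube (nat n).
     (\<forall>j < nat n. j \<noteq> i \<longrightarrow> s ! j = t ! j) \<longrightarrow> T s = T t)"

definition dQ ::
  "('a \<Rightarrow> 'a \<Rightarrow> bool) \<Rightarrow> 'a set \<Rightarrow> int \<Rightarrow> ((int list \<Rightarrow> 'a) \<Rightarrow>\<^sub>0 int) monoid" where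
  "dQ \<kappa> X n = free_Abelian_group (dcubes \<kappa> X n)"

definition dD ::
  "('a \<Rightarrow> 'a \<Rightarrow> bool) \<Rightarrow> 'a set \<Rightarrow> int \<Rightarrow> ((int list \<Rightarrow> 'a) \<Rightarrow>\<^sub>0 int) set" where
  "dD \<kappa> X n = generate (dQ \<kappa> X n) (frag_of ` {T \<in> dcubes \<kappa> X n. degenerate n T})"

definition dC ::
  "('a \<Rightarrow> 'a \<Rightarrow> bool) \<Rightarrow> 'a set \<Rightarrow> int \<Rightarrow> ((int list \<Rightarrow> 'a) \<Rightarrow>\<^sub>0 int) set monoid" where
  "dC \<kappa> X n = dQ \<kappa> X n Mod dD \<kappa> X n"

text \<open>The face of an \<open>n\<close>-cube obtained by setting the \<open>i\<close>-th coordinate (counted from 1) to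
  \<open>e\<close>, so that \<open>A\<^sub>i\<close> and \<open>B\<^sub>i\<close> are the cases \<open>e = 0\<close> and \<open>e = 1\<close>.\<close>

definition face :: "int \<Rightarrow> int \<Rightarrow> nat \<Rightarrow> (int list \<Rightarrow> 'a) \<Rightarrow> (int list \<Rightarrow> 'a)" where
  "face e n i T = (\<lambda>t \<in> unit_cube (nat n - 1). T (take (i - 1) t @ e # drop (i - 1) t))"

definition bdQ :: "int \<Rightarrow> ((int list \<Rightarrow> 'a) \<Rightarrow>\<^sub>0 int) \<Rightarrow> ((int list \<Rightarrow> 'a) \<Rightarrow>\<^sub>0 int)" where
  "bdQ n = (if n \<le> 0 then (\<lambda>_. 0) else
     frag_extend (\<lambda>T. \<Sum>i = 1..nat n.
       frag_cmul ((-1) ^ i) (frag_of (face 0 n i T) - frag_of (face 1 n i T))))"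

text \<open>The map \<open>G/N \<rightarrow> H/M\<close> induced by \<open>h : G \<rightarrow> H\<close>, as a function on cosets of \<open>N\<close>: for
  a homomorphism with \<open>h ` N \<subseteq> M\<close>, all elements of a coset give the same coset of \<open>M\<close>.\<close>

definition quot_map :: "('b, 'c) monoid_scheme \<Rightarrow> 'b set \<Rightarrow> ('a \<Rightarrow> 'b) \<Rightarrow> 'a set \<Rightarrow> 'b set" where
  "quot_map H M h K = the_elem ((\<lambda>x. M #>\<^bsub>H\<^esub> h x) ` K)"

definition bdC ::
  "('a \<Rightarrow> 'a \<Rightarrow> bool) \<Rightarrow> 'a set \<Rightarrow> int \<Rightarrow>
     ((int list \<Rightarrow> 'a) \<Rightarrow>\<^sub>0 int) set \<Rightarrow> ((int list \<Rightarrow> 'a) \<Rightarrow>\<^sub>0 int) set" where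
  "bdC \<kappa> X n = quot_map (dQ \<kappa> X (n - 1)) (dD \<kappa> X (n - 1)) (bdQ n)"

section \<open>Relative homology\<close>

text \<open>\<open>dC\<^sub>n(A)\<close> as a subgroup of \<open>dC\<^sub>n(X)\<close>: its image under the map of quotients induced by
  the inclusion of \<open>dQ\<^sub>n(A)\<close> in \<open>dQ\<^sub>n(X)\<close>.\<close>

definition dC_sub ::
  "('a \<Rightarrow> 'a \<Rightarrow> bool) \<Rightarrow> 'a set \<Rightarrow> 'a set \<Rightarrow> int \<Rightarrow> ((int list \<Rightarrow> 'a) \<Rightarrow>\<^sub>0 int) set set" where
  "dC_sub \<kappa> X A n = quot_map (dQ \<kappa> X n) (dD \<kappa> X n) (\<lambda>c. c) ` carrier (dC \<kappa> A n)"

definition dC_rel ::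
  "('a \<Rightarrow> 'a \<Rightarrow> bool) \<Rightarrow> 'a set \<Rightarrow> 'a set \<Rightarrow> int \<Rightarrow>
     ((int list \<Rightarrow> 'a) \<Rightarrow>\<^sub>0 int) set set monoid" where
  "dC_rel \<kappa> X A n = dC \<kappa> X n Mod dC_sub \<kappa> X A n"

definition bd_rel ::
  "('a \<Rightarrow> 'a \<Rightarrow> bool) \<Rightarrow> 'a set \<Rightarrow> 'a set \<Rightarrow> int \<Rightarrow>
     ((int list \<Rightarrow> 'a) \<Rightarrow>\<^sub>0 int) set set \<Rightarrow> ((int list \<Rightarrow> 'a) \<Rightarrow>\<^sub>0 int) set set" where
  "bd_rel \<kappa> X A n = quot_map (dC \<kappa> X (n - 1)) (dC_sub \<kappa> X A (n - 1)) (bdC \<kappa> X n)"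

definition dB_rel ::
  "('a \<Rightarrow> 'a \<Rightarrow> bool) \<Rightarrow> 'a set \<Rightarrow> 'a set \<Rightarrow> int \<Rightarrow>
     ((int list \<Rightarrow> 'a) \<Rightarrow>\<^sub>0 int) set set set" where
  "dB_rel \<kappa> X A n = bd_rel \<kappa> X A (n + 1) ` carrier (dC_rel \<kappa> X A (n + 1))"

definition dH ::
  "('a \<Rightarrow> 'a \<Rightarrow> bool) \<Rightarrow> 'a set \<Rightarrow> 'a set \<Rightarrow> int \<Rightarrow>
     ((int list \<Rightarrow> 'a) \<Rightarrow>\<^sub>0 int) set set set monoid" where
  "dH \<kappa> X A n =
     subgroup_generated (dC_rel \<kappa> X A n)
       (kernel (dC_rel \<kappa> X A n) (dC_rel \<kappa> X A (n - 1)) (bd_rel \<kappa> X A n))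
     Mod dB_rel \<kappa> X A n"

section \<open>Induced maps\<close>

definition mapQ ::
  "('a \<Rightarrow> 'b) \<Rightarrow> int \<Rightarrow> ((int list \<Rightarrow> 'a) \<Rightarrow>\<^sub>0 int) \<Rightarrow> ((int list \<Rightarrow> 'b) \<Rightarrow>\<^sub>0 int)" where
  "mapQ f n = frag_extend (\<lambda>T. frag_of (compose (unit_cube (nat n)) f T))"

definition mapC ::
  "('b \<Rightarrow> 'b \<Rightarrow> bool) \<Rightarrow> 'b set \<Rightarrow> ('a \<Rightarrow> 'b) \<Rightarrow> int \<Rightarrow>
     ((int list \<Rightarrow> 'a) \<Rightarrow>\<^sub>0 int) set \<Rightarrow> ((int list \<Rightarrow> 'b) \<Rightarrow>\<^sub>0 int) set" where
  "mapC \<mu> Y f n = quot_map (dQ \<mu> Y n) (dD \<mu> Y n) (mapQ f n)"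

definition mapC_rel ::
  "('b \<Rightarrow> 'b \<Rightarrow> bool) \<Rightarrow> 'b set \<Rightarrow> 'b set \<Rightarrow> ('a \<Rightarrow> 'b) \<Rightarrow> int \<Rightarrow>
     ((int list \<Rightarrow> 'a) \<Rightarrow>\<^sub>0 int) set set \<Rightarrow> ((int list \<Rightarrow> 'b) \<Rightarrow>\<^sub>0 int) set set" where
  "mapC_rel \<mu> Y B f n = quot_map (dC \<mu> Y n) (dC_sub \<mu> Y B n) (mapC \<mu> Y f n)"

text \<open>\<open>f\<^sub>* : dH\<^sub>n(X,A) \<rightarrow> dH\<^sub>n(Y,B)\<close>. The source pair enters only through the carrier on which
  the function is considered. In the definition of \<open>dH\<close> the group structure on the relative
  cycles is that of \<open>dC_rel\<close>, so cosets can be formed there.\<close>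

definition mapH ::
  "('b \<Rightarrow> 'b \<Rightarrow> bool) \<Rightarrow> 'b set \<Rightarrow> 'b set \<Rightarrow> ('a \<Rightarrow> 'b) \<Rightarrow> int \<Rightarrow>
     ((int list \<Rightarrow> 'a) \<Rightarrow>\<^sub>0 int) set set set \<Rightarrow> ((int list \<Rightarrow> 'b) \<Rightarrow>\<^sub>0 int) set set set" where
  "mapH \<mu> Y B f n = quot_map (dC_rel \<mu> Y B n) (dB_rel \<mu> Y B n) (mapC_rel \<mu> Y B f n)"

end

(* A cube of dimension at most i + 1 in X = Int^i(A) \<union> Int^i(B) lies in A or in B. Hence
   C_m(B, A \<inter> B) \<rightarrow> C_m(X, A) is an isomorphism for all m \<le> i + 1, and so is the map in homology
   in degrees n \<le> i: no subdivision is needed. Part (1) is part (2) for B = X - W. *)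

theory Submission
  imports Defs
begin

section \<open>Maps between quotients of abelian groups\<close>

text \<open>Why no large cube can straddle: if \<open>T p\<close> is outside \<open>A\<close> and
  \<open>T q\<close> outside \<open>B\<close>, some vertex \<open>w\<close> is at most
  \<open>i\<close> coordinate changes away from both. \<open>T w\<close> lies in one of the two
  iterated interiors, and each coordinate change uses up one layer of it, so \<open>T p\<close> is
  in \<open>A\<close> or \<open>T q\<close> is in \<open>B\<close>. The chain isomorphism is then
  the second isomorphism theorem, with \<open>dC(A) + dC(B) = dC(X)\<close> and
  \<open>dC(A) \<inter> dC(B) = dC(A \<inter> B)\<close>. Homology is a quotient of a quotient of a
  quotient, so this is not argued on cosets: the degenerate chains, and the chains whose class lies
  in \<open>dC(A)\<close>, are both spanned by sets of basis cubes, and membership becomes a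
  condition on the support of a representative. The range \<open>n \<le> i\<close> arises because
  homology in degree \<open>n\<close> sees chains up to degree \<open>n + 1\<close>.\<close>

lemma (in comm_group) rcos_eq_iff:
  assumes "subgroup N G" "x \<in> carrier G" "y \<in> carrier G"
  shows "N #> x = N #> y \<longleftrightarrow> x \<otimes> inv y \<in> N"
proof
  assume "N #> x = N #> y"
  then have "x \<in> N #> y"
    using rcos_self[OF assms(2,1)] by simp
  then show "x \<otimes> inv y \<in> N"
    by (rule subgroup.rcos_module_imp[OF assms(1) is_group assms(3)])
next
  assume "x \<otimes> inv y \<in> N"
  then have "x \<in> N #> y"
    by (rule subgroup.rcos_module_rev[OF assms(1) is_group assms(3,2)])
  then show "N #> x = N #> y"
    using repr_independence[OF _ assms(3,1)] by simp
qed

lemma (in comm_group) rcos_mult: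
  assumes "subgroup N G" "x \<in> carrier G" "y \<in> carrier G"
  shows "(N #> x) <#> (N #> y) = N #> (x \<otimes> y)"
  by (rule normal.rcos_sum[OF subgroup_imp_normal[OF assms(1)] assms(2,3)])

text \<open>Two representatives of a coset of \<open>N\<close> differ by an element that
  \<open>h\<close> sends into \<open>M\<close>, so \<open>the_elem\<close> in
  \<open>quot_map\<close> is applied to a singleton. All later evaluations of induced maps rest on
  this.\<close>

lemma quot_map_rcos:
  assumes G: "comm_group G" and H: "comm_group H"
    and N: "subgroup N G" and M: "subgroup M H"
    and h: "h \<in> hom G H" and hN: "h ` N \<subseteq> M" and x: "x \<in> carrier G"
  shows "quot_map H M h (N #>\<^bsub>G\<^esub> x) = M #>\<^bsub>H\<^esub> h x"
proof -
  interpret G: comm_group G by fact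
  interpret H: comm_group H by fact
  have "M #>\<^bsub>H\<^esub> h y = M #>\<^bsub>H\<^esub> h x" if y: "y \<in> N #>\<^bsub>G\<^esub> x" for y
  proof -
    obtain k where k: "k \<in> N" "y = k \<otimes>\<^bsub>G\<^esub> x"
      using y unfolding r_coset_def by blast
    have "k \<in> carrier G"
      using k N subgroup.mem_carrier by metis
    then have "h y = h k \<otimes>\<^bsub>H\<^esub> h x"
      using k x h hom_mult by metis
    moreover have "h k \<in> M" using k hN by auto
    moreover have "h x \<in> carrier H" using h x hom_in_carrier by metis
    ultimately have "h y \<in> M #>\<^bsub>H\<^esub> h x" by (auto simp: r_coset_def)
    then show ?thesis
      using H.repr_independence[OF _ \<open>h x \<in> carrier H\<close> M] by simp
  qed
  moreover have "x \<in> N #>\<^bsub>G\<^esub> x"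
    using G.rcos_self N x by simp
  ultimately have "(\<lambda>y. M #>\<^bsub>H\<^esub> h y) ` (N #>\<^bsub>G\<^esub> x) = {M #>\<^bsub>H\<^esub> h x}"
    by blast
  then show ?thesis by (simp add: quot_map_def)
qed

lemma quot_map_hom:
  assumes G: "comm_group G" and H: "comm_group H"
    and N: "subgroup N G" and M: "subgroup M H"
    and h: "h \<in> hom G H" and hN: "h ` N \<subseteq> M"
  shows "quot_map H M h \<in> hom (G Mod N) (H Mod M)"
proof (rule homI)
  note q = quot_map_rcos[OF assms]
  fix K assume "K \<in> carrier (G Mod N)"
  then show "quot_map H M h K \<in> carrier (H Mod M)"
    using h hom_in_carrier by (fastforce simp: carrier_FactGroup q)
next
  note q = quot_map_rcos[OF assms]
  fix K L assume "K \<in> carrier (G Mod N)" "L \<in> carrier (G Mod N)"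
  then obtain x y where xy: "x \<in> carrier G" "y \<in> carrier G"
    and K: "K = N #>\<^bsub>G\<^esub> x" "L = N #>\<^bsub>G\<^esub> y"
    by (auto simp: carrier_FactGroup)
  have hxy: "h x \<in> carrier H" "h y \<in> carrier H" "h (x \<otimes>\<^bsub>G\<^esub> y) = h x \<otimes>\<^bsub>H\<^esub> h y"
    using h xy hom_in_carrier hom_mult by metis+
  have "x \<otimes>\<^bsub>G\<^esub> y \<in> carrier G"
    using xy G by (simp add: comm_group.axioms(2) group.is_monoid monoid.m_closed)
  then show "quot_map H M h (K \<otimes>\<^bsub>G Mod N\<^esub> L)
      = quot_map H M h K \<otimes>\<^bsub>H Mod M\<^esub> quot_map H M h L"
    using K xy hxy by (simp add: comm_group.rcos_mult[OF G N] comm_group.rcos_mult[OF H M] q)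
qed

text \<open>\<open>subgroup_generated\<close> changes only the carrier, so cosets formed among
  cycles are cosets in the ambient chain group. This is what lets one \<open>quot_map\<close> serve
  both.\<close>

lemma rcos_subgroup_generated [simp]: "N #>\<^bsub>subgroup_generated G Z\<^esub> x = N #>\<^bsub>G\<^esub> x"
  by (simp add: r_coset_def)

lemma set_mult_subgroup_generated [simp]:
  "set_mult (subgroup_generated G Z) = set_mult G"
  by (intro ext) (simp add: set_mult_def)

text \<open>The cycles \<open>Z\<close> need not contain the boundaries \<open>N\<close> here, so the identity
  \<open>\<partial>\<partial> = 0\<close> is not needed to apply this to homology.\<close>

lemma quot_map_iso:
  assumes G: "comm_group G" and H: "comm_group H"
    and N: "subgroup N G" and M: "subgroup M H"
    and h: "h \<in> hom G H" and hN: "h ` N \<subseteq> M"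
    and Z: "subgroup Z G" and Y: "subgroup Y H" and hZ: "h ` Z \<subseteq> Y"
    and inj: "\<And>z. z \<in> Z \<Longrightarrow> h z \<in> M \<Longrightarrow> z \<in> N"
    and surj: "\<And>y. y \<in> Y \<Longrightarrow> \<exists>m\<in>M. \<exists>z\<in>Z. y = m \<otimes>\<^bsub>H\<^esub> h z"
  shows "quot_map H M h \<in> iso (subgroup_generated G Z Mod N) (subgroup_generated H Y Mod M)"
proof -
  interpret G: comm_group G by fact
  interpret H: comm_group H by fact
  interpret h: group_hom G H h
    using h by unfold_locales
  note q = quot_map_rcos[OF G H N M h hN]
  have ZG: "z \<in> carrier G" if "z \<in> Z" for z
    using Z that subgroup.mem_carrier by metis
  have YH: "y \<in> carrier H" if "y \<in> Y" for y
    using Y that subgroup.mem_carrier by metis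
  have cZ: "carrier (subgroup_generated G Z Mod N) = (\<lambda>x. N #>\<^bsub>G\<^esub> x) ` Z"
    by (simp add: carrier_FactGroup subgroup.carrier_subgroup_generated_subgroup[OF Z])
  have cY: "carrier (subgroup_generated H Y Mod M) = (\<lambda>x. M #>\<^bsub>H\<^esub> x) ` Y"
    by (simp add: carrier_FactGroup subgroup.carrier_subgroup_generated_subgroup[OF Y])
  have "quot_map H M h \<in> hom (subgroup_generated G Z Mod N) (subgroup_generated H Y Mod M)"
  proof (rule homI)
    fix K assume "K \<in> carrier (subgroup_generated G Z Mod N)"
    then show "quot_map H M h K \<in> carrier (subgroup_generated H Y Mod M)"
      using hZ by (auto simp: cZ cY q ZG)
  next
    fix K L
    assume "K \<in> carrier (subgroup_generated G Z Mod N)" "L \<in> carrier (subgroup_generated G Z Mod N)"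
    \<comment> \<open>Products of cosets are the same in the restricted and the full quotient, so
      multiplicativity is inherited from the map on all of \<open>G Mod N\<close>.\<close>
    then have "K \<in> carrier (G Mod N)" "L \<in> carrier (G Mod N)"
      using ZG unfolding cZ carrier_FactGroup[of G N] by blast+
    then show "quot_map H M h (K \<otimes>\<^bsub>subgroup_generated G Z Mod N\<^esub> L)
        = quot_map H M h K \<otimes>\<^bsub>subgroup_generated H Y Mod M\<^esub> quot_map H M h L"
      using hom_mult[OF quot_map_hom[OF G H N M h hN]] by simp
  qed
  moreover have "inj_on (quot_map H M h) (carrier (subgroup_generated G Z Mod N))"
  proof (rule inj_onI)
    fix K L
    assume "K \<in> carrier (subgroup_generated G Z Mod N)" "L \<in> carrier (subgroup_generated G Z Mod N)"
      and eq: "quot_map H M h K = quot_map H M h L"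
    then obtain x y where xy: "x \<in> Z" "y \<in> Z" and K: "K = N #>\<^bsub>G\<^esub> x" "L = N #>\<^bsub>G\<^esub> y"
      by (auto simp: cZ)
    have "M #>\<^bsub>H\<^esub> h x = M #>\<^bsub>H\<^esub> h y"
      using eq K xy by (simp add: q ZG)
    then have "h (x \<otimes>\<^bsub>G\<^esub> inv\<^bsub>G\<^esub> y) \<in> M"
      using xy M by (simp add: H.rcos_eq_iff ZG)
    moreover have "x \<otimes>\<^bsub>G\<^esub> inv\<^bsub>G\<^esub> y \<in> Z"
      using xy Z by (simp add: subgroup.m_closed subgroup.m_inv_closed)
    ultimately have "x \<otimes>\<^bsub>G\<^esub> inv\<^bsub>G\<^esub> y \<in> N" using inj by blast
    then show "K = L"
      using K xy N by (simp add: G.rcos_eq_iff ZG)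
  qed
  moreover have "carrier (subgroup_generated H Y Mod M)
      \<subseteq> quot_map H M h ` carrier (subgroup_generated G Z Mod N)"
  proof
    fix L assume "L \<in> carrier (subgroup_generated H Y Mod M)"
    then obtain y where y: "y \<in> Y" "L = M #>\<^bsub>H\<^esub> y" by (auto simp: cY)
    then obtain m z where mz: "m \<in> M" "z \<in> Z" "y = m \<otimes>\<^bsub>H\<^esub> h z"
      using surj by blast
    have "y \<in> M #>\<^bsub>H\<^esub> h z" using mz by (auto simp: r_coset_def)
    then have "L = M #>\<^bsub>H\<^esub> h z"
      using y H.repr_independence[OF _ h.hom_closed[OF ZG[OF \<open>z \<in> Z\<close>]] M] by simp
    then show "L \<in> quot_map H M h ` carrier (subgroup_generated G Z Mod N)"
      using mz by (auto simp: cZ q ZG intro!: image_eqI[of _ _ "N #>\<^bsub>G\<^esub> z"])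
  qed
  ultimately show ?thesis
    by (simp add: iso_iff hom_carrier subset_antisym)
qed

section \<open>Faces and degenerate cubes\<close>

text \<open>The point at which a face evaluates its cube. Positions count from 0 here and from 1 in
  \<open>face\<close>, hence \<open>k = i - 1\<close> below.\<close>

definition ins_coord :: "nat \<Rightarrow> int \<Rightarrow> int list \<Rightarrow> int list" where
  "ins_coord k e t = take k t @ e # drop k t"

lemma length_ins_coord [simp]: "length (ins_coord k e t) = Suc (length t)"
  by (simp add: ins_coord_def)

lemma nth_ins_coord:
  assumes "k \<le> length t" "j \<le> length t"
  shows "ins_coord k e t ! j = (if j < k then t ! j else if j = k then e else t ! (j - 1))"
  using assms by (auto simp: ins_coord_def nth_append nth_Cons')

lemma ins_coord_unit_cube:
  assumes "t \<in> unit_cube m" "e \<in> {0, 1}"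
  shows "ins_coord k e t \<in> unit_cube (Suc m)"
  using assms by (auto simp: unit_cube_def ins_coord_def dest: in_set_takeD in_set_dropD)

lemma unit_cube_nth:
  assumes "t \<in> unit_cube m" "j < m"
  shows "t ! j = 0 \<or> t ! j = 1"
  using assms nth_mem by (fastforce simp: unit_cube_def)

text \<open>The inserted entry is common to both points and the other entries only shift, so the
  positions of disagreement inject into the old ones. Faces are therefore composites of continuous
  maps.\<close>

lemma c_adj_ins_coord:
  assumes adj: "c_adj l s t" and k: "k \<le> length s"
  shows "c_adj l (ins_coord k e s) (ins_coord k e t)"
proof -
  have len: "length s = length t" using adj by (simp add: c_adj_def)
  define D where "D = {j. j < length s \<and> s ! j \<noteq> t ! j}"
  have diff: "{j. j < length (ins_coord k e s) \<and> ins_coord k e s ! j \<noteq> ins_coord k e t ! j}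
      \<subseteq> (\<lambda>j. if j < k then j else Suc j) ` D"
  proof
    fix j assume "j \<in> {j. j < length (ins_coord k e s) \<and> ins_coord k e s ! j \<noteq> ins_coord k e t ! j}"
    then have "j < Suc (length s)" "ins_coord k e s ! j \<noteq> ins_coord k e t ! j" by auto
    then have "(j < k \<and> j \<in> D) \<or> (k < j \<and> j - 1 \<in> D)"
      using k len by (auto simp: nth_ins_coord D_def split: if_splits)
    then show "j \<in> (\<lambda>j. if j < k then j else Suc j) ` D"
      by (auto simp: image_iff intro!: bexI[of _ "if j < k then j else j - 1"])
  qed
  have "finite D" by (simp add: D_def)
  then have "card {j. j < length (ins_coord k e s) \<and> ins_coord k e s ! j \<noteq> ins_coord k e t ! j}
      \<le> card D"
    using diff by (meson card_image_le card_mono finite_imageI order_trans)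
  moreover have "card D \<le> l" using adj unfolding c_adj_def D_def by blast
  moreover have "ins_coord k e s \<noteq> ins_coord k e t"
    using adj len by (auto simp: ins_coord_def c_adj_def)
      (metis append_take_drop_id)
  moreover have "\<bar>ins_coord k e s ! j - ins_coord k e t ! j\<bar> = 1"
    if "j < Suc (length s)" "ins_coord k e s ! j \<noteq> ins_coord k e t ! j" for j
    using that adj k len by (auto simp: nth_ins_coord c_adj_def split: if_splits)
  ultimately show ?thesis
    using len by (auto simp: c_adj_def)
qed

lemma face_eq:
  "face e n i T = (\<lambda>t \<in> unit_cube (nat n - 1). T (ins_coord (i - 1) e t))"
  by (simp add: face_def ins_coord_def)

lemma face_in_dcubes:
  assumes T: "T \<in> dcubes \<kappa> X n" and n: "0 < n" and i: "i \<in> {1..nat n}" and e: "e \<in> {0, 1}"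
  shows "face e n i T \<in> dcubes \<kappa> X (n - 1)"
proof -
  define m where "m = nat n - 1"
  have m: "nat n = Suc m" "nat (n - 1) = m" using n by (auto simp: m_def)
  have T': "T \<in> unit_cube (Suc m) \<rightarrow> X"
    "\<And>s t. s \<in> unit_cube (Suc m) \<Longrightarrow> t \<in> unit_cube (Suc m) \<Longrightarrow> c_adj 1 s t \<Longrightarrow>
        T s = T t \<or> \<kappa> (T s) (T t)"
    using T n m by (auto simp: dcubes_def dcontinuous_def)
  have adj: "c_adj 1 (ins_coord (i - 1) e s) (ins_coord (i - 1) e t)"
    if "c_adj 1 s t" "s \<in> unit_cube m" for s t
    using that c_adj_ins_coord i m by (auto simp: unit_cube_def)
  have ins: "ins_coord (i - 1) e t \<in> unit_cube (Suc m)" if "t \<in> unit_cube m" for t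
    using that e ins_coord_unit_cube by blast
  show ?thesis
    using n T' adj ins by (auto simp: face_eq dcubes_def dcontinuous_def m)
qed

text \<open>If the fixed coordinate is the one \<open>T\<close> ignores, the two opposite faces
  coincide; otherwise the ignored coordinate survives in both faces. In either case the difference
  is a degenerate chain, so \<open>bdQ\<close> preserves \<open>dD\<close>.\<close>

lemma degenerate_face_diff:
  assumes deg: "degenerate n T" and n: "0 < n" and i: "i \<in> {1..nat n}"
  shows "face 0 n i T = face 1 n i T
    \<or> (degenerate (n - 1) (face 0 n i T) \<and> degenerate (n - 1) (face 1 n i T))"
proof -
  define m where "m = nat n - 1"
  have m: "nat n = Suc m" "nat (n - 1) = m" using n by (auto simp: m_def)
  obtain k where k: "k < Suc m"
    and indep: "\<And>s t. s \<in> unit_cube (Suc m) \<Longrightarrow> t \<in> unit_cube (Suc m) \<Longrightarrow>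
      (\<And>j. j < Suc m \<Longrightarrow> j \<noteq> k \<Longrightarrow> s ! j = t ! j) \<Longrightarrow> T s = T t"
    using deg unfolding degenerate_def m by blast
  show ?thesis
  proof (cases "i - 1 = k")
    case True
    have "T (ins_coord (i - 1) 0 t) = T (ins_coord (i - 1) 1 t)" if "t \<in> unit_cube m" for t
    proof (rule indep)
      fix j assume "j < Suc m" "j \<noteq> k"
      then show "ins_coord (i - 1) 0 t ! j = ins_coord (i - 1) 1 t ! j"
        using True k that by (auto simp: nth_ins_coord unit_cube_def)
    qed (use that ins_coord_unit_cube in auto)
    then show ?thesis
      by (auto simp: face_eq m)
  next
    case False
    have "degenerate (n - 1) (face e n i T)" if e: "e \<in> {0, 1}" for e
    proof -
      \<comment> \<open>The position of the ignored coordinate \<open>k\<close> once coordinate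
        \<open>i - 1\<close> has been removed.\<close>
      define k' where "k' = (if k < i - 1 then k else k - 1)"
      have k': "k' < m" using k False i m by (auto simp: k'_def)
      have face: "face e n i T t = T (ins_coord (i - 1) e t)" if "t \<in> unit_cube m" for t
        using that by (simp add: face_eq m)
      have "face e n i T s = face e n i T t"
        if st: "s \<in> unit_cube m" "t \<in> unit_cube m"
          and eq: "\<And>j. j < m \<Longrightarrow> j \<noteq> k' \<Longrightarrow> s ! j = t ! j" for s t
        unfolding face[OF st(1)] face[OF st(2)]
      proof (rule indep)
        fix j assume j: "j < Suc m" "j \<noteq> k"
        have len: "length s = m" "length t = m" using st by (auto simp: unit_cube_def)
        have im: "i - 1 \<le> m" using i m by auto
        have "s ! j = t ! j" if "j < i - 1"
          using that j im False by (intro eq) (auto simp: k'_def)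
        moreover have "s ! (j - 1) = t ! (j - 1)" if "i - 1 < j"
          using that j False by (intro eq) (auto simp: k'_def)
        ultimately show "ins_coord (i - 1) e s ! j = ins_coord (i - 1) e t ! j"
          using im j len by (simp add: nth_ins_coord)
      qed (use st e ins_coord_unit_cube in auto)
      then show ?thesis
        unfolding degenerate_def m using k' by blast
    qed
    then show ?thesis by simp
  qed
qed

lemma dcubes_mono: "A \<subseteq> X \<Longrightarrow> dcubes \<kappa> A n \<subseteq> dcubes \<kappa> X n"
  by (auto simp: dcubes_def dcontinuous_def)

lemma dcubes_Int: "dcubes \<kappa> (A \<inter> B) n = dcubes \<kappa> A n \<inter> dcubes \<kappa> B n"
  by (auto simp: dcubes_def dcontinuous_def)

text \<open>Opposite faces are kept together as a difference. A degenerate cube can have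
  nondegenerate faces that cancel in pairs, and a bound by single faces would lose this
  cancellation.\<close>

lemma keys_bdQ:
  assumes n: "0 < n"
  shows "Poly_Mapping.keys (bdQ n c) \<subseteq> (\<Union>T \<in> Poly_Mapping.keys c. \<Union>i \<in> {1..nat n}.
    Poly_Mapping.keys (frag_of (face 0 n i T) - frag_of (face 1 n i T)))"
proof -
  have "Poly_Mapping.keys (\<Sum>i = 1..nat n.
       frag_cmul ((-1) ^ i) (frag_of (face 0 n i T) - frag_of (face 1 n i T)))
     \<subseteq> (\<Union>i \<in> {1..nat n}. Poly_Mapping.keys (frag_of (face 0 n i T) - frag_of (face 1 n i T)))"
    for T :: "int list \<Rightarrow> 'a"
    using keys_cmul by (intro order_trans[OF keys_sum]) (blast)
  then show ?thesis
    using n unfolding bdQ_def by (simp, intro order_trans[OF keys_frag_extend]) blast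
qed

lemma bdQ_dcubes:
  assumes "Poly_Mapping.keys c \<subseteq> dcubes \<kappa> X n"
  shows "Poly_Mapping.keys (bdQ n c) \<subseteq> dcubes \<kappa> X (n - 1)"
proof (cases "0 < n")
  case True
  have "Poly_Mapping.keys (frag_of (face 0 n i T) - frag_of (face 1 n i T)) \<subseteq> dcubes \<kappa> X (n - 1)"
    if "T \<in> Poly_Mapping.keys c" "i \<in> {1..nat n}" for T i
    using that assms True by (intro order_trans[OF keys_diff]) (auto intro!: face_in_dcubes)
  then show ?thesis
    using keys_bdQ[OF True, of c] by blast
qed (simp add: bdQ_def)

lemma bdQ_degenerate:
  assumes "\<And>T. T \<in> Poly_Mapping.keys c \<Longrightarrow> degenerate n T"
    and "S \<in> Poly_Mapping.keys (bdQ n c)"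
  shows "degenerate (n - 1) S"
proof (cases "0 < n")
  case True
  then obtain T i where T: "T \<in> Poly_Mapping.keys c" and i: "i \<in> {1..nat n}"
    and S: "S \<in> Poly_Mapping.keys (frag_of (face 0 n i T) - frag_of (face 1 n i T))"
    using keys_bdQ[OF True, of c] assms(2) by blast
  \<comment> \<open>Equal faces would have a difference with empty support, which excludes the
    cancelling case.\<close>
  have "face 0 n i T \<noteq> face 1 n i T" using S by auto
  then have "degenerate (n - 1) (face 0 n i T)" "degenerate (n - 1) (face 1 n i T)"
    using degenerate_face_diff[OF assms(1)[OF T] True i] by auto
  moreover have "S = face 0 n i T \<or> S = face 1 n i T"
    using S keys_diff[of "frag_of (face 0 n i T)" "frag_of (face 1 n i T)"] by auto
  ultimately show ?thesis by auto
qed (use assms(2) in \<open>simp add: bdQ_def\<close>)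

lemma bdQ_add: "bdQ n (a + b) = bdQ n a + bdQ n b"
  by (simp add: bdQ_def frag_extend_add)

section \<open>Relative chains\<close>

text \<open>Turns membership in a subgroup spanned by basis elements into a condition on supports;
  through \<open>dD_eq\<close> this is how degenerate chains are handled.\<close>

lemma generate_frag_of:
  assumes "S' \<subseteq> S"
  shows "generate (free_Abelian_group S) (frag_of ` S') = {c. Poly_Mapping.keys c \<subseteq> S'}"
proof
  show "generate (free_Abelian_group S) (frag_of ` S') \<subseteq> {c. Poly_Mapping.keys c \<subseteq> S'}"
  proof
    fix c assume "c \<in> generate (free_Abelian_group S) (frag_of ` S')"
    then show "c \<in> {c. Poly_Mapping.keys c \<subseteq> S'}"
    proof induction
      case (inv h)
      then show ?case using assms by auto
    next
      case (eng a b)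
      then show ?case using keys_add[of a b] by auto
    qed auto
  qed
next
  interpret group "free_Abelian_group S" by simp
  have sub: "subgroup (generate (free_Abelian_group S) (frag_of ` S')) (free_Abelian_group S)"
    using assms by (intro generate_is_subgroup) auto
  show "{c. Poly_Mapping.keys c \<subseteq> S'} \<subseteq> generate (free_Abelian_group S) (frag_of ` S')"
  proof clarify
    fix c :: "'a \<Rightarrow>\<^sub>0 int" assume "Poly_Mapping.keys c \<subseteq> S'"
    then show "c \<in> generate (free_Abelian_group S) (frag_of ` S')"
    proof (induction c rule: frag_induction)
      case zero
      then show ?case using subgroup.one_closed[OF sub] by simp
    next
      case (one x)
      then show ?case by (auto intro: generate.incl)
    next
      case (diff a b)
      have "b \<in> carrier (free_Abelian_group S)"
        by (rule subgroup.mem_carrier[OF sub diff(2)])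
      then have "- b \<in> generate (free_Abelian_group S) (frag_of ` S')"
        using subgroup.m_inv_closed[OF sub diff(2)] by simp
      then show ?case
        using subgroup.m_closed[OF sub diff(1)] by fastforce
    qed
  qed
qed

lemma carrier_dQ [simp]: "c \<in> carrier (dQ \<kappa> X n) \<longleftrightarrow> Poly_Mapping.keys c \<subseteq> dcubes \<kappa> X n"
  by (simp add: dQ_def)

lemma mult_dQ [simp]: "a \<otimes>\<^bsub>dQ \<kappa> X n\<^esub> b = a + b"
  by (simp add: dQ_def)

lemma inv_dQ [simp]: "Poly_Mapping.keys a \<subseteq> dcubes \<kappa> X n \<Longrightarrow> inv\<^bsub>dQ \<kappa> X n\<^esub> a = - a"
  by (simp add: dQ_def)

lemma comm_group_dQ: "comm_group (dQ \<kappa> X n)"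
  by (simp add: dQ_def abelian_free_Abelian_group)

lemma dD_eq: "dD \<kappa> X n = {c. Poly_Mapping.keys c \<subseteq> {T \<in> dcubes \<kappa> X n. degenerate n T}}"
  unfolding dD_def dQ_def by (rule generate_frag_of) blast

lemma subgroup_dD: "subgroup (dD \<kappa> X n) (dQ \<kappa> X n)"
  unfolding dD_def dQ_def
  by (intro group.generate_is_subgroup group_free_Abelian_group) auto

lemma comm_group_dC: "comm_group (dC \<kappa> X n)"
  unfolding dC_def by (intro comm_group.abelian_FactGroup comm_group_dQ subgroup_dD)

definition chain_class ::
  "('a \<Rightarrow> 'a \<Rightarrow> bool) \<Rightarrow> 'a set \<Rightarrow> int \<Rightarrow>
     ((int list \<Rightarrow> 'a) \<Rightarrow>\<^sub>0 int) \<Rightarrow> ((int list \<Rightarrow> 'a) \<Rightarrow>\<^sub>0 int) set" where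
  "chain_class \<kappa> X n c = dD \<kappa> X n #>\<^bsub>dQ \<kappa> X n\<^esub> c"

lemma carrier_dC: "carrier (dC \<kappa> X n) = chain_class \<kappa> X n ` carrier (dQ \<kappa> X n)"
  unfolding dC_def carrier_FactGroup chain_class_def ..

lemma chain_class_add:
  assumes "Poly_Mapping.keys a \<subseteq> dcubes \<kappa> X n" "Poly_Mapping.keys b \<subseteq> dcubes \<kappa> X n"
  shows "chain_class \<kappa> X n a \<otimes>\<^bsub>dC \<kappa> X n\<^esub> chain_class \<kappa> X n b = chain_class \<kappa> X n (a + b)"
  using comm_group.rcos_mult[OF comm_group_dQ subgroup_dD, of a \<kappa> X n b] assms
  by (simp add: chain_class_def dC_def)

lemma quot_map_chain_class:
  assumes "h \<in> hom (dQ \<kappa> X n) (dQ \<mu> Y m)" "h ` dD \<kappa> X n \<subseteq> dD \<mu> Y m"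
    and "Poly_Mapping.keys c \<subseteq> dcubes \<kappa> X n"
  shows "quot_map (dQ \<mu> Y m) (dD \<mu> Y m) h (chain_class \<kappa> X n c) = chain_class \<mu> Y m (h c)"
  unfolding chain_class_def
  by (rule quot_map_rcos[OF comm_group_dQ comm_group_dQ subgroup_dD subgroup_dD])
    (use assms in auto)

lemma incl_dQ:
  assumes "A \<subseteq> X"
  shows "(\<lambda>c. c) \<in> hom (dQ \<kappa> A n) (dQ \<kappa> X n)" "(\<lambda>c. c) ` dD \<kappa> A n \<subseteq> dD \<kappa> X n"
  using dcubes_mono[OF assms, of \<kappa> n] by (auto simp: hom_def dD_eq)

lemma dC_sub_eq:
  assumes "A \<subseteq> X"
  shows "dC_sub \<kappa> X A n = chain_class \<kappa> X n ` carrier (dQ \<kappa> A n)"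
  unfolding dC_sub_def carrier_dC image_image
  by (rule image_cong) (use incl_dQ[OF assms, of \<kappa> n] in \<open>auto simp: quot_map_chain_class\<close>)

lemma subgroup_dC_sub:
  assumes "A \<subseteq> X"
  shows "subgroup (dC_sub \<kappa> X A n) (dC \<kappa> X n)"
proof -
  have "quot_map (dQ \<kappa> X n) (dD \<kappa> X n) (\<lambda>c. c) \<in> hom (dC \<kappa> A n) (dC \<kappa> X n)"
    unfolding dC_def
    by (intro quot_map_hom comm_group_dQ subgroup_dD incl_dQ[OF assms])
  then have "group_hom (dC \<kappa> A n) (dC \<kappa> X n) (quot_map (dQ \<kappa> X n) (dD \<kappa> X n) (\<lambda>c. c))"
    using comm_group_dC comm_group.axioms(2)
    by (auto simp: group_hom_def group_hom_axioms_def)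
  then show ?thesis
    unfolding dC_sub_def by (rule group_hom.img_is_subgroup)
qed

lemma comm_group_dC_rel: "A \<subseteq> X \<Longrightarrow> comm_group (dC_rel \<kappa> X A n)"
  unfolding dC_rel_def by (intro comm_group.abelian_FactGroup comm_group_dC subgroup_dC_sub)

text \<open>The preimage of \<open>dC(A)\<close> in \<open>dQ(X)\<close> is the sum of
  \<open>dD(X)\<close> and \<open>dQ(A)\<close>, which is spanned by the degenerate cubes together
  with the cubes of \<open>A\<close>. Membership is therefore decided one cube at a time.\<close>

lemma chain_class_in_dC_sub_iff:
  assumes A: "A \<subseteq> X" and c: "Poly_Mapping.keys c \<subseteq> dcubes \<kappa> X n"
  shows "chain_class \<kappa> X n c \<in> dC_sub \<kappa> X A n \<longleftrightarrow>
    (\<forall>T \<in> Poly_Mapping.keys c. degenerate n T \<or> T \<in> dcubes \<kappa> A n)"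
proof
  assume "chain_class \<kappa> X n c \<in> dC_sub \<kappa> X A n"
  then obtain a where a: "Poly_Mapping.keys a \<subseteq> dcubes \<kappa> A n"
    and eq: "chain_class \<kappa> X n c = chain_class \<kappa> X n a"
    using A by (auto simp: dC_sub_eq)
  have aX: "Poly_Mapping.keys a \<subseteq> dcubes \<kappa> X n"
    using a dcubes_mono[OF A] by blast
  then have "c - a \<in> dD \<kappa> X n"
    using eq comm_group.rcos_eq_iff[OF comm_group_dQ subgroup_dD, of c \<kappa> X n a] c
    by (simp add: chain_class_def)
  moreover have "Poly_Mapping.keys c \<subseteq> Poly_Mapping.keys (c - a) \<union> Poly_Mapping.keys a"
    using keys_add[of "c - a" a] by simp
  ultimately show "\<forall>T \<in> Poly_Mapping.keys c. degenerate n T \<or> T \<in> dcubes \<kappa> A n"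
    using a by (auto simp: dD_eq)
next
  assume "\<forall>T \<in> Poly_Mapping.keys c. degenerate n T \<or> T \<in> dcubes \<kappa> A n"
  then have "Poly_Mapping.keys c \<subseteq> {T \<in> dcubes \<kappa> X n. degenerate n T} \<union> dcubes \<kappa> A n"
    using c by blast
  then obtain d a where d: "Poly_Mapping.keys d \<subseteq> {T \<in> dcubes \<kappa> X n. degenerate n T}"
    and a: "Poly_Mapping.keys a \<subseteq> dcubes \<kappa> A n" and eq: "d + a = c"
    by (rule frag_split)
  have aX: "Poly_Mapping.keys a \<subseteq> dcubes \<kappa> X n"
    using a dcubes_mono[OF A] by blast
  have "c - a \<in> dD \<kappa> X n"
    using d eq by (auto simp: dD_eq)
  then have "chain_class \<kappa> X n c = chain_class \<kappa> X n a"
    using comm_group.rcos_eq_iff[OF comm_group_dQ subgroup_dD, of c \<kappa> X n a] c aX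
    by (simp add: chain_class_def)
  then show "chain_class \<kappa> X n c \<in> dC_sub \<kappa> X A n"
    using A a by (auto simp: dC_sub_eq)
qed

lemma bdQ_hom:
  shows "bdQ n \<in> hom (dQ \<kappa> X n) (dQ \<kappa> X (n - 1))" "bdQ n ` dD \<kappa> X n \<subseteq> dD \<kappa> X (n - 1)"
proof -
  show "bdQ n \<in> hom (dQ \<kappa> X n) (dQ \<kappa> X (n - 1))"
    using bdQ_dcubes[of _ \<kappa> X n] by (auto simp: hom_def bdQ_add)
  show "bdQ n ` dD \<kappa> X n \<subseteq> dD \<kappa> X (n - 1)"
  proof clarify
    fix c assume "c \<in> dD \<kappa> X n"
    then have c: "Poly_Mapping.keys c \<subseteq> dcubes \<kappa> X n"
      "\<And>T. T \<in> Poly_Mapping.keys c \<Longrightarrow> degenerate n T"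
      by (auto simp: dD_eq)
    show "bdQ n c \<in> dD \<kappa> X (n - 1)"
      using bdQ_dcubes[OF c(1)] bdQ_degenerate[OF c(2)] by (auto simp: dD_eq)
  qed
qed

lemma bdC_chain_class:
  "Poly_Mapping.keys c \<subseteq> dcubes \<kappa> X n \<Longrightarrow>
    bdC \<kappa> X n (chain_class \<kappa> X n c) = chain_class \<kappa> X (n - 1) (bdQ n c)"
  unfolding bdC_def by (intro quot_map_chain_class bdQ_hom)

lemma bdC_hom: "bdC \<kappa> X n \<in> hom (dC \<kappa> X n) (dC \<kappa> X (n - 1))"
  unfolding bdC_def dC_def by (intro quot_map_hom comm_group_dQ subgroup_dD bdQ_hom)

lemma bdC_dC_sub:
  assumes "A \<subseteq> X"
  shows "bdC \<kappa> X n ` dC_sub \<kappa> X A n \<subseteq> dC_sub \<kappa> X A (n - 1)"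
proof
  fix y assume "y \<in> bdC \<kappa> X n ` dC_sub \<kappa> X A n"
  then obtain c where c: "Poly_Mapping.keys c \<subseteq> dcubes \<kappa> A n"
    and y: "y = bdC \<kappa> X n (chain_class \<kappa> X n c)"
    by (auto simp: dC_sub_eq[OF assms])
  have "Poly_Mapping.keys c \<subseteq> dcubes \<kappa> X n"
    using c dcubes_mono[OF assms] by blast
  then have "y = chain_class \<kappa> X (n - 1) (bdQ n c)"
    by (simp add: y bdC_chain_class)
  then show "y \<in> dC_sub \<kappa> X A (n - 1)"
    using bdQ_dcubes[OF c] by (simp add: dC_sub_eq[OF assms])
qed

lemma bd_rel_hom:
  assumes "A \<subseteq> X"
  shows "bd_rel \<kappa> X A n \<in> hom (dC_rel \<kappa> X A n) (dC_rel \<kappa> X A (n - 1))"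
  unfolding bd_rel_def dC_rel_def
  by (intro quot_map_hom comm_group_dC subgroup_dC_sub bdC_hom bdC_dC_sub assms)

lemma bd_rel_rcos:
  assumes "A \<subseteq> X" "x \<in> carrier (dC \<kappa> X n)"
  shows "bd_rel \<kappa> X A n (dC_sub \<kappa> X A n #>\<^bsub>dC \<kappa> X n\<^esub> x)
    = dC_sub \<kappa> X A (n - 1) #>\<^bsub>dC \<kappa> X (n - 1)\<^esub> bdC \<kappa> X n x"
  unfolding bd_rel_def
  by (intro quot_map_rcos comm_group_dC subgroup_dC_sub bdC_hom bdC_dC_sub assms)

section \<open>Inclusions of pairs\<close>

text \<open>Cubes are extensional, so composing with the identity and restricting to the unit cube
  returns the same function.\<close>

lemma mapQ_incl:
  assumes "Poly_Mapping.keys c \<subseteq> dcubes \<kappa> X n"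
  shows "mapQ (\<lambda>x. x) n c = c"
proof -
  have "frag_of (compose (unit_cube (nat n)) (\<lambda>x. x) T) = frag_of T"
    if "T \<in> Poly_Mapping.keys c" for T
  proof -
    have "T \<in> extensional (unit_cube (nat n))"
      using that assms by (auto simp: dcubes_def split: if_splits)
    then have "compose (unit_cube (nat n)) (\<lambda>x. x) T = T"
      by (auto simp: compose_def extensional_def fun_eq_iff)
    then show ?thesis by simp
  qed
  then have "mapQ (\<lambda>x. x) n c = frag_extend frag_of c"
    unfolding mapQ_def by (rule frag_extend_eq)
  then show ?thesis by (simp flip: frag_expansion)
qed

lemma mapQ_incl_hom:
  assumes "B \<subseteq> X"
  shows "mapQ (\<lambda>x. x) n \<in> hom (dQ \<kappa> B n) (dQ \<kappa> X n)"
    and "mapQ (\<lambda>x. x) n ` dD \<kappa> B n \<subseteq> dD \<kappa> X n"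
proof -
  show "mapQ (\<lambda>x. x) n \<in> hom (dQ \<kappa> B n) (dQ \<kappa> X n)"
  proof (rule homI)
    fix a assume "a \<in> carrier (dQ \<kappa> B n)"
    then show "mapQ (\<lambda>x. x) n a \<in> carrier (dQ \<kappa> X n)"
      using dcubes_mono[OF assms, of \<kappa> n] mapQ_incl[of a \<kappa> B n] by simp
  qed (simp add: mapQ_def frag_extend_add)
  show "mapQ (\<lambda>x. x) n ` dD \<kappa> B n \<subseteq> dD \<kappa> X n"
  proof clarify
    fix c assume c: "c \<in> dD \<kappa> B n"
    then have "mapQ (\<lambda>x. x) n c = c"
      by (intro mapQ_incl[of _ \<kappa> B]) (auto simp: dD_eq)
    then show "mapQ (\<lambda>x. x) n c \<in> dD \<kappa> X n"
      using c dcubes_mono[OF assms, of \<kappa> n] by (auto simp: dD_eq)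
  qed
qed

lemma mapC_incl_chain_class:
  assumes "B \<subseteq> X" "Poly_Mapping.keys c \<subseteq> dcubes \<kappa> B n"
  shows "mapC \<kappa> X (\<lambda>x. x) n (chain_class \<kappa> B n c) = chain_class \<kappa> X n c"
  unfolding mapC_def
  using quot_map_chain_class[OF mapQ_incl_hom[OF assms(1)] assms(2)] mapQ_incl[OF assms(2)]
  by simp

lemma mapC_incl_hom:
  assumes "B \<subseteq> X"
  shows "mapC \<kappa> X (\<lambda>x. x) n \<in> hom (dC \<kappa> B n) (dC \<kappa> X n)"
  unfolding mapC_def dC_def
  by (intro quot_map_hom comm_group_dQ subgroup_dD mapQ_incl_hom assms)

context
  fixes \<kappa> :: "'a \<Rightarrow> 'a \<Rightarrow> bool" and X A B :: "'a set"
  assumes A: "A \<subseteq> X" and B: "B \<subseteq> X"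
begin

lemma mapC_incl_dC_sub:
  "mapC \<kappa> X (\<lambda>x. x) n ` dC_sub \<kappa> B (A \<inter> B) n \<subseteq> dC_sub \<kappa> X A n"
proof -
  have "A \<inter> B \<subseteq> B" by blast
  then show ?thesis
    using B by (auto simp: dC_sub_eq A mapC_incl_chain_class dcubes_Int)
qed

lemma mapC_rel_incl_rcos:
  assumes "x \<in> carrier (dC \<kappa> B n)"
  shows "mapC_rel \<kappa> X A (\<lambda>x. x) n (dC_sub \<kappa> B (A \<inter> B) n #>\<^bsub>dC \<kappa> B n\<^esub> x)
    = dC_sub \<kappa> X A n #>\<^bsub>dC \<kappa> X n\<^esub> mapC \<kappa> X (\<lambda>x. x) n x"
  unfolding mapC_rel_def
  by (intro quot_map_rcos comm_group_dC subgroup_dC_sub mapC_incl_hom mapC_incl_dC_sub assms A B)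
    blast

text \<open>The inclusion leaves a representing chain \<open>c\<close> unchanged, so both composites
  give the class of \<open>bdQ n c\<close> in the pair \<open>(X, A)\<close>.\<close>

lemma bd_rel_mapC_rel_incl:
  assumes z: "z \<in> carrier (dC_rel \<kappa> B (A \<inter> B) n)"
  shows "bd_rel \<kappa> X A n (mapC_rel \<kappa> X A (\<lambda>x. x) n z)
    = mapC_rel \<kappa> X A (\<lambda>x. x) (n - 1) (bd_rel \<kappa> B (A \<inter> B) n z)"
proof -
  obtain c where c: "Poly_Mapping.keys c \<subseteq> dcubes \<kappa> B n"
    and z: "z = dC_sub \<kappa> B (A \<inter> B) n #>\<^bsub>dC \<kappa> B n\<^esub> chain_class \<kappa> B n c"
    using z by (auto simp: dC_rel_def carrier_FactGroup carrier_dC)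
  have AB: "A \<inter> B \<subseteq> B" by blast
  have cX: "Poly_Mapping.keys c \<subseteq> dcubes \<kappa> X n"
    using c dcubes_mono[OF B] by blast
  have bc: "Poly_Mapping.keys (bdQ n c) \<subseteq> dcubes \<kappa> B (n - 1)"
    using c by (rule bdQ_dcubes)
  have car: "chain_class \<kappa> B n c \<in> carrier (dC \<kappa> B n)"
    "chain_class \<kappa> X n c \<in> carrier (dC \<kappa> X n)"
    "chain_class \<kappa> B (n - 1) (bdQ n c) \<in> carrier (dC \<kappa> B (n - 1))"
    using c cX bc by (auto simp: carrier_dC)
  show ?thesis
    using c cX bc car
    by (simp add: z mapC_rel_incl_rcos mapC_incl_chain_class B bd_rel_rcos A AB bdC_chain_class)
qed

text \<open>Second isomorphism theorem. By \<open>small\<close> every chain of \<open>X\<close>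
  splits into a part in \<open>A\<close>, which vanishes in the relative group, and a part in
  \<open>B\<close>; this gives surjectivity. Injectivity is the comparison of supports.\<close>

lemma mapC_rel_incl_iso:
  assumes small: "dcubes \<kappa> X n \<subseteq> dcubes \<kappa> A n \<union> dcubes \<kappa> B n"
  shows "mapC_rel \<kappa> X A (\<lambda>x. x) n \<in> iso (dC_rel \<kappa> B (A \<inter> B) n) (dC_rel \<kappa> X A n)"
proof -
  have AB: "A \<inter> B \<subseteq> B" by blast
  have gr: "group (dC \<kappa> X n)" "group (dC \<kappa> B n)"
    using comm_group_dC comm_group.axioms(2) by blast+
  \<comment> \<open>The whole carriers play the role of \<open>Z\<close> and \<open>Y\<close>, so
    that \<open>quot_map_iso\<close> applies; \<open>subgroup_generated_group_carrier\<close>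
    removes them again.\<close>
  have "mapC_rel \<kappa> X A (\<lambda>x. x) n
    \<in> iso (subgroup_generated (dC \<kappa> B n) (carrier (dC \<kappa> B n)) Mod dC_sub \<kappa> B (A \<inter> B) n)
          (subgroup_generated (dC \<kappa> X n) (carrier (dC \<kappa> X n)) Mod dC_sub \<kappa> X A n)"
    unfolding mapC_rel_def
  proof (rule quot_map_iso)
    fix z assume "z \<in> carrier (dC \<kappa> B n)" and *: "mapC \<kappa> X (\<lambda>x. x) n z \<in> dC_sub \<kappa> X A n"
    then obtain c where c: "Poly_Mapping.keys c \<subseteq> dcubes \<kappa> B n" "z = chain_class \<kappa> B n c"
      by (auto simp: carrier_dC)
    then have "chain_class \<kappa> X n c \<in> dC_sub \<kappa> X A n"
      using * by (simp add: mapC_incl_chain_class B)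
    moreover have "Poly_Mapping.keys c \<subseteq> dcubes \<kappa> X n"
      using c dcubes_mono[OF B] by blast
    \<comment> \<open>All cubes of \<open>c\<close> lie in \<open>B\<close>, so those that lie in
      \<open>A\<close> lie in \<open>A \<inter> B\<close>; the predicate \<open>degenerate\<close>
      does not refer to the ambient set, so degeneracy in \<open>X\<close> and in \<open>B\<close>
      agree.\<close>
    ultimately show "z \<in> dC_sub \<kappa> B (A \<inter> B) n"
      using c by (auto simp: chain_class_in_dC_sub_iff A AB dcubes_Int)
  next
    fix y assume "y \<in> carrier (dC \<kappa> X n)"
    then obtain c where c: "Poly_Mapping.keys c \<subseteq> dcubes \<kappa> X n" "y = chain_class \<kappa> X n c"
      by (auto simp: carrier_dC)
    then have "Poly_Mapping.keys c \<subseteq> dcubes \<kappa> A n \<union> dcubes \<kappa> B n"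
      using small by blast
    then obtain a b where a: "Poly_Mapping.keys a \<subseteq> dcubes \<kappa> A n"
      and b: "Poly_Mapping.keys b \<subseteq> dcubes \<kappa> B n" and "a + b = c"
      by (rule frag_split)
    moreover have "Poly_Mapping.keys a \<subseteq> dcubes \<kappa> X n" "Poly_Mapping.keys b \<subseteq> dcubes \<kappa> X n"
      using a b dcubes_mono[OF A] dcubes_mono[OF B] by blast+
    ultimately have "y = chain_class \<kappa> X n a \<otimes>\<^bsub>dC \<kappa> X n\<^esub> mapC \<kappa> X (\<lambda>x. x) n (chain_class \<kappa> B n b)"
      by (simp add: c chain_class_add mapC_incl_chain_class B)
    moreover have "chain_class \<kappa> X n a \<in> dC_sub \<kappa> X A n"
      using a by (simp add: dC_sub_eq A)
    moreover have "chain_class \<kappa> B n b \<in> carrier (dC \<kappa> B n)"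
      using b by (simp add: carrier_dC)
    ultimately show "\<exists>m\<in>dC_sub \<kappa> X A n. \<exists>z\<in>carrier (dC \<kappa> B n).
        y = m \<otimes>\<^bsub>dC \<kappa> X n\<^esub> mapC \<kappa> X (\<lambda>x. x) n z"
      by blast
  next
    show "mapC \<kappa> X (\<lambda>x. x) n ` carrier (dC \<kappa> B n) \<subseteq> carrier (dC \<kappa> X n)"
      using hom_carrier[OF mapC_incl_hom[OF B]] .
  qed (intro comm_group_dC subgroup_dC_sub mapC_incl_hom mapC_incl_dC_sub A B AB
        group.subgroup_self gr)+
  then show ?thesis
    using gr by (simp add: group.subgroup_generated_group_carrier dC_rel_def)
qed

text \<open>Three degrees enter: surjectivity in degree \<open>n + 1\<close> matches the boundaries,
  bijectivity in degree \<open>n\<close> matches the chains, and injectivity in degree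
  \<open>n - 1\<close> shows that the preimage of a cycle is a cycle.\<close>

lemma mapH_incl_iso:
  assumes small: "\<And>m. m \<le> n + 1 \<Longrightarrow> dcubes \<kappa> X m \<subseteq> dcubes \<kappa> A m \<union> dcubes \<kappa> B m"
  shows "mapH \<kappa> X A (\<lambda>x. x) n \<in> iso (dH \<kappa> B (A \<inter> B) n) (dH \<kappa> X A n)"
proof -
  define C where "C = dC_rel \<kappa> X A"
  define C' where "C' = dC_rel \<kappa> B (A \<inter> B)"
  define bd where "bd = bd_rel \<kappa> X A"
  define bd' where "bd' = bd_rel \<kappa> B (A \<inter> B)"
  define \<phi> where "\<phi> = mapC_rel \<kappa> X A (\<lambda>x. x)"
  have cg: "comm_group (C m)" "comm_group (C' m)" for m
    unfolding C_def C'_def by (intro comm_group_dC_rel A; blast)+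
  then have gr: "group (C m)" "group (C' m)" for m
    using comm_group.axioms(2) by blast+
  have bd: "group_hom (C m) (C (m - 1)) (bd m)" "group_hom (C' m) (C' (m - 1)) (bd' m)" for m
    using gr bd_rel_hom[OF A] bd_rel_hom[of "A \<inter> B" B]
    by (auto simp: group_hom_def group_hom_axioms_def C_def C'_def bd_def bd'_def)
  have comm: "bd m (\<phi> m z) = \<phi> (m - 1) (bd' m z)" if "z \<in> carrier (C' m)" for m z
    using that bd_rel_mapC_rel_incl by (simp add: C'_def bd_def bd'_def \<phi>_def)
  have iso: "\<phi> m \<in> iso (C' m) (C m)" if "m \<le> n + 1" for m
    using mapC_rel_incl_iso[OF small[OF that]] by (simp add: C_def C'_def \<phi>_def)
  have hom: "\<phi> m \<in> hom (C' m) (C m)" and onto: "\<phi> m ` carrier (C' m) = carrier (C m)"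
    and inj: "inj_on (\<phi> m) (carrier (C' m))" if "m \<le> n + 1" for m
    using iso[OF that] by (simp_all add: iso_iff)
  have \<phi>_one: "\<phi> (n - 1) \<one>\<^bsub>C' (n - 1)\<^esub> = \<one>\<^bsub>C (n - 1)\<^esub>"
    using hom_one[OF hom gr(2) gr(1)] by simp
  have B1: "dB_rel \<kappa> X A n = bd (n + 1) ` carrier (C (n + 1))"
    and B2: "dB_rel \<kappa> B (A \<inter> B) n = bd' (n + 1) ` carrier (C' (n + 1))"
    by (simp_all add: dB_rel_def bd_def bd'_def C_def C'_def)
  have sub: "subgroup (dB_rel \<kappa> X A n) (C n)" "subgroup (dB_rel \<kappa> B (A \<inter> B) n) (C' n)"
    using group_hom.img_is_subgroup[OF bd(1)[of "n + 1"]]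
      group_hom.img_is_subgroup[OF bd(2)[of "n + 1"]] by (simp_all add: B1 B2)
  \<comment> \<open>Since \<open>\<phi> (n + 1)\<close> is onto, every boundary in
    \<open>(X, A)\<close> is the boundary of an image, hence the image of a boundary.\<close>
  have im: "\<phi> n ` dB_rel \<kappa> B (A \<inter> B) n = dB_rel \<kappa> X A n"
  proof -
    have "\<phi> n ` dB_rel \<kappa> B (A \<inter> B) n = (\<lambda>z. bd (n + 1) (\<phi> (n + 1) z)) ` carrier (C' (n + 1))"
      unfolding B2 image_image by (rule image_cong) (use comm[of _ "n + 1"] in auto)
    also have "\<dots> = dB_rel \<kappa> X A n"
      unfolding B1 onto[of "n + 1", simplified, symmetric] image_image ..
    finally show ?thesis .
  qed
  have bd_closed: "bd' n z \<in> carrier (C' (n - 1))" if "z \<in> carrier (C' n)" for z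
    using group_hom.hom_closed[OF bd(2)] that by blast
  have dB_closed: "dB_rel \<kappa> B (A \<inter> B) n \<subseteq> carrier (C' n)"
    using sub(2) subgroup.subset by blast
  have "quot_map (C n) (dB_rel \<kappa> X A n) (\<phi> n)
    \<in> iso (subgroup_generated (C' n) (kernel (C' n) (C' (n - 1)) (bd' n)) Mod dB_rel \<kappa> B (A \<inter> B) n)
          (subgroup_generated (C n) (kernel (C n) (C (n - 1)) (bd n)) Mod dB_rel \<kappa> X A n)"
  proof (rule quot_map_iso)
    show "\<phi> n ` dB_rel \<kappa> B (A \<inter> B) n \<subseteq> dB_rel \<kappa> X A n" using im by simp
    show "\<phi> n ` kernel (C' n) (C' (n - 1)) (bd' n) \<subseteq> kernel (C n) (C (n - 1)) (bd n)"
      using onto[of n] by (auto simp: kernel_def comm \<phi>_one)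
  next
    fix z assume "z \<in> kernel (C' n) (C' (n - 1)) (bd' n)" "\<phi> n z \<in> dB_rel \<kappa> X A n"
    then obtain w where "w \<in> dB_rel \<kappa> B (A \<inter> B) n" "\<phi> n z = \<phi> n w" "z \<in> carrier (C' n)"
      by (auto simp: kernel_def im[symmetric])
    then show "z \<in> dB_rel \<kappa> B (A \<inter> B) n"
      using inj_onD[OF inj[of n]] dB_closed by auto
  next
    fix y assume y: "y \<in> kernel (C n) (C (n - 1)) (bd n)"
    then have "y \<in> \<phi> n ` carrier (C' n)"
      using onto[of n] by (simp add: kernel_def)
    then obtain z where z: "z \<in> carrier (C' n)" "y = \<phi> n z" by blast
    \<comment> \<open>The boundary of \<open>z\<close> has trivial image because \<open>y\<close> is
      a cycle; injectivity one degree below then makes \<open>z\<close> a cycle.\<close>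
    have "\<phi> (n - 1) (bd' n z) = \<phi> (n - 1) \<one>\<^bsub>C' (n - 1)\<^esub>"
      using y z by (simp add: kernel_def comm \<phi>_one)
    then have "bd' n z = \<one>\<^bsub>C' (n - 1)\<^esub>"
      using inj_onD[OF inj[of "n - 1"]] bd_closed[OF z(1)] gr(2) by (simp add: group.is_monoid)
    then have "z \<in> kernel (C' n) (C' (n - 1)) (bd' n)"
      using z by (simp add: kernel_def)
    \<comment> \<open>Cycles lift exactly, not merely up to a boundary, so the correcting boundary
      \<open>m\<close> is the neutral element.\<close>
    moreover have "y = \<one>\<^bsub>C n\<^esub> \<otimes>\<^bsub>C n\<^esub> \<phi> n z"
      using y z gr(1) by (simp add: kernel_def group.is_monoid)
    ultimately show "\<exists>m\<in>dB_rel \<kappa> X A n. \<exists>z\<in>kernel (C' n) (C' (n - 1)) (bd' n). y = m \<otimes>\<^bsub>C n\<^esub> \<phi> n z"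
      using subgroup.one_closed[OF sub(1)] by blast
  qed (use cg sub hom group_hom.subgroup_kernel[OF bd(1)] group_hom.subgroup_kernel[OF bd(2)] in auto)
  then show ?thesis
    by (simp add: mapH_def dH_def C_def C'_def bd_def bd'_def \<phi>_def)
qed

end

section \<open>Cubes of small dimension\<close>

lemma funpow_dInt_subset: "(dInt \<kappa> X ^^ i) A \<subseteq> A"
  by (induction i) (auto simp: dInt_def)

lemma c_adj_list_update:
  assumes "s \<in> unit_cube m" "j < m" "e \<in> {0, 1}" "s ! j \<noteq> e"
  shows "c_adj 1 (s[j := e]) s"
proof -
  have len: "length s = m" using assms by (simp add: unit_cube_def)
  have diff: "s[j := e] ! k \<noteq> s ! k \<longleftrightarrow> k = j" if "k < m" for k
    using that assms(4) len by (cases "k = j") simp_all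
  then have "{k. k < length (s[j := e]) \<and> s[j := e] ! k \<noteq> s ! k} = {j}"
    using len assms(2) by auto
  moreover have "s[j := e] \<noteq> s" using diff[OF assms(2)] by auto
  moreover have "\<bar>s[j := e] ! j - s ! j\<bar> = 1"
    using assms(2-4) len unit_cube_nth[OF assms(1,2)] by auto
  then have "\<bar>s[j := e] ! k - s ! k\<bar> = 1" if "k < m" "s[j := e] ! k \<noteq> s ! k" for k
    using that diff by metis
  ultimately show ?thesis
    using len by (simp add: c_adj_def)
qed

lemma list_update_unit_cube:
  assumes "s \<in> unit_cube m" "e \<in> {0, 1}"
  shows "s[j := e] \<in> unit_cube m"
  using assms set_update_subset_insert[of s j e] by (auto simp: unit_cube_def)

text \<open>Walk from \<open>s\<close> to \<open>t\<close>, correcting one differing coordinate at a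
  time. Each correction moves the image within a neighbourhood and so costs one application of
  \<open>dInt\<close>; \<open>i\<close> layers suffice for \<open>i\<close> corrections.\<close>

lemma dcontinuous_unit_cube_dInt:
  assumes T: "dcontinuous (c_adj 1) (unit_cube m) \<kappa> X T"
    and "s \<in> unit_cube m" "t \<in> unit_cube m"
    and "T s \<in> (dInt \<kappa> X ^^ i) A"
    and "card {j. j < m \<and> s ! j \<noteq> t ! j} \<le> i"
  shows "T t \<in> A"
  using assms(2-)
proof (induction i arbitrary: s)
  case 0
  then have "s = t"
    by (intro nth_equalityI) (auto simp: unit_cube_def)
  then show ?case using 0 by simp
next
  case (Suc i)
  show ?case
  proof (cases "s = t")
    case True
    \<comment> \<open>The walk may arrive before the layers are used up; the remaining ones are
      discarded, since interiors shrink.\<close>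
    then show ?thesis using Suc.prems(3) subsetD[OF funpow_dInt_subset] by metis
  next
    case False
    then obtain j where j: "j < m" "s ! j \<noteq> t ! j"
      using Suc.prems(1,2) nth_equalityI[of s t] by (auto simp: unit_cube_def)
    define u where "u = s[j := t ! j]"
    have tj: "t ! j \<in> {0, 1}" using unit_cube_nth[OF Suc.prems(2) j(1)] by auto
    have u: "u \<in> unit_cube m"
      unfolding u_def by (rule list_update_unit_cube[OF Suc.prems(1) tj])
    \<comment> \<open>The order matters: \<open>nbhd\<close> puts the centre second, so the new
      vertex \<open>u\<close> must come first.\<close>
    have "c_adj 1 u s"
      unfolding u_def by (rule c_adj_list_update[OF Suc.prems(1) j(1) tj j(2)])
    then have "T u = T s \<or> \<kappa> (T u) (T s)" "T u \<in> X"
      using T u Suc.prems(1) by (auto simp: dcontinuous_def)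
    then have "T u \<in> nbhd \<kappa> X (T s)"
      by (simp add: nbhd_def)
    moreover have "nbhd \<kappa> X (T s) \<subseteq> (dInt \<kappa> X ^^ i) A"
      using Suc.prems(3) by (simp add: dInt_def[of \<kappa> X "(dInt \<kappa> X ^^ i) A"])
    ultimately have "T u \<in> (dInt \<kappa> X ^^ i) A" by blast
    moreover have "{k. k < m \<and> u ! k \<noteq> t ! k} = {k. k < m \<and> s ! k \<noteq> t ! k} - {j}"
      using Suc.prems(1) j(1) by (auto simp: u_def nth_list_update unit_cube_def)
    then have "card {k. k < m \<and> u ! k \<noteq> t ! k} \<le> i"
      using Suc.prems(4) j by (simp add: card_Diff_singleton)
    ultimately show ?thesis using Suc.IH u Suc.prems(2) by blast
  qed
qed

text \<open>Cubes of dimension up to \<open>i + 1\<close> are covered, although \<open>Int\<^sup>i\<close> only controls distance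
  \<open>i\<close>: two points of \<open>I\<^sup>m\<close> always have a common point \<open>w\<close> at distance at most 1 from one and
  at most \<open>m - 1\<close> from the other.\<close>

lemma dcubes_small:
  assumes X: "X = (dInt \<kappa> X ^^ i) A \<union> (dInt \<kappa> X ^^ i) B"
    and i: "0 < i" and m: "m \<le> int i + 1"
  shows "dcubes \<kappa> X m \<subseteq> dcubes \<kappa> A m \<union> dcubes \<kappa> B m"
proof
  fix T assume T: "T \<in> dcubes \<kappa> X m"
  then have m0: "0 \<le> m" by (auto simp: dcubes_def split: if_splits)
  define k where "k = nat m"
  have k: "k \<le> Suc i" using m m0 by (simp add: k_def)
  have cont: "dcontinuous (c_adj 1) (unit_cube k) \<kappa> X T"
    using T m0 by (simp add: dcubes_def k_def)
  show "T \<in> dcubes \<kappa> A m \<union> dcubes \<kappa> B m"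
  proof (rule ccontr)
    assume not: "T \<notin> dcubes \<kappa> A m \<union> dcubes \<kappa> B m"
    \<comment> \<open>The adjacency on a subset is that of \<open>X\<close>, so a cube of
      \<open>X\<close> can fail to be a cube of \<open>A\<close> or \<open>B\<close> only by having
      a vertex outside.\<close>
    have "\<exists>p \<in> unit_cube k. T p \<notin> A" "\<exists>q \<in> unit_cube k. T q \<notin> B"
      using not T m0 by (auto simp: dcubes_def dcontinuous_def k_def)
    then obtain p q where p: "p \<in> unit_cube k" "T p \<notin> A" and q: "q \<in> unit_cube k" "T q \<notin> B"
      by blast
    have "\<exists>w \<in> unit_cube k. card {j. j < k \<and> w ! j \<noteq> p ! j} \<le> i \<and> card {j. j < k \<and> w ! j \<noteq> q ! j} \<le> i"
    proof (cases "p = q")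
      case True
      then show ?thesis using p by (intro bexI[of _ p]) auto
    next
      case False
      then obtain j where j: "j < k" "p ! j \<noteq> q ! j"
        using p q nth_equalityI[of p q] by (auto simp: unit_cube_def)
      define w where "w = p[j := q ! j]"
      have qj: "q ! j \<in> {0, 1}" using unit_cube_nth[OF q(1) j(1)] by auto
      have w: "w \<in> unit_cube k"
        unfolding w_def by (rule list_update_unit_cube[OF p(1) qj])
      have len: "length p = k" using p by (simp add: unit_cube_def)
      have "{l. l < k \<and> w ! l \<noteq> p ! l} \<subseteq> {j}"
        by (auto simp: w_def) (metis nth_list_update_neq)
      \<comment> \<open>Positivity of \<open>i\<close> pays for the single coordinate in which
        \<open>w\<close> differs from \<open>p\<close>.\<close>
      then have "card {l. l < k \<and> w ! l \<noteq> p ! l} \<le> i"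
        using i card_mono[of "{j}" "{l. l < k \<and> w ! l \<noteq> p ! l}"] by simp
      moreover have "{l. l < k \<and> w ! l \<noteq> q ! l} \<subseteq> {..<k} - {j}"
        using len by (auto simp: w_def nth_list_update split: if_splits)
      \<comment> \<open>Coordinate \<open>j\<close> already agrees with \<open>q\<close>, leaving at
        most \<open>k - 1\<close> differences; this is where the bound \<open>i + 1\<close> on the
        dimension comes from.\<close>
      then have "card {l. l < k \<and> w ! l \<noteq> q ! l} \<le> i"
        using k j card_mono[of "{..<k} - {j}" "{l. l < k \<and> w ! l \<noteq> q ! l}"] by simp
      ultimately show ?thesis using w by blast
    qed
    then obtain w where w: "w \<in> unit_cube k"
      "card {j. j < k \<and> w ! j \<noteq> p ! j} \<le> i" "card {j. j < k \<and> w ! j \<noteq> q ! j} \<le> i"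
      by blast
    have "T w \<in> X" using cont w by (auto simp: dcontinuous_def)
    then have "T w \<in> (dInt \<kappa> X ^^ i) A \<or> T w \<in> (dInt \<kappa> X ^^ i) B" using X by blast
    then show False
      using dcontinuous_unit_cube_dInt[OF cont w(1)] w p q by blast
  qed
qed

section \<open>Excision\<close>

text \<open>A neighbourhood lies in \<open>X - V\<close> exactly when it misses \<open>V\<close>, so
  interior and closure are dual under complement, and the duality iterates.\<close>

lemma funpow_dInt_Diff: "(dInt \<kappa> X ^^ i) (X - W) = X - (dCl \<kappa> X ^^ i) W"
proof (induction i)
  case (Suc i)
  have "dInt \<kappa> X (X - V) = X - dCl \<kappa> X V" for V
    by (auto simp: dInt_def dCl_def nbhd_def)
  then show ?case using Suc by simp
qed simp

lemma excision:
  assumes "A \<subseteq> X" "B \<subseteq> X" "0 < i" "X = (dInt \<kappa> X ^^ i) A \<union> (dInt \<kappa> X ^^ i) B"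
    and "n < int i + 1"
  shows "mapH \<kappa> X A (\<lambda>x. x) n \<in> iso (dH \<kappa> B (A \<inter> B) n) (dH \<kappa> X A n)"
  \<comment> \<open>For integers, \<open>n < i + 1\<close> gives \<open>n + 1 \<le> i + 1\<close>,
    so every degree required by \<open>mapH_incl_iso\<close> is within the range of
    \<open>dcubes_small\<close>.\<close>
  using assms by (intro mapH_incl_iso dcubes_small) auto

theorem theorem5p10:
  fixes d l :: nat and X :: "int list set" and \<kappa> :: "int list \<Rightarrow> int list \<Rightarrow> bool"
  assumes "digital_image d l X" and "\<kappa> = c_adj l"
  shows
    "(\<forall>A W i. A \<subseteq> X \<longrightarrow> W \<subseteq> X \<longrightarrow> 0 < i \<longrightarrow> (dCl \<kappa> X ^^ i) W \<subseteq> (dInt \<kappa> X ^^ i) A \<longrightarrow>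
        (\<forall>n::int. n < int i + 1 \<longrightarrow>
           mapH \<kappa> X A (\<lambda>x. x) n \<in> iso (dH \<kappa> (X - W) (A - W) n) (dH \<kappa> X A n)))
     \<and>
     (\<forall>A B i. A \<subseteq> X \<longrightarrow> B \<subseteq> X \<longrightarrow> 0 < i \<longrightarrow> X = (dInt \<kappa> X ^^ i) A \<union> (dInt \<kappa> X ^^ i) B \<longrightarrow>
        (\<forall>n::int. n < int i + 1 \<longrightarrow>
           mapH \<kappa> X A (\<lambda>x. x) n \<in> iso (dH \<kappa> B (A \<inter> B) n) (dH \<kappa> X A n)))"
proof (intro conjI allI impI)
  fix A W i and n :: int
  assume A: "A \<subseteq> X" and i: "0 < i" "n < int i + 1"
    and W: "(dCl \<kappa> X ^^ i) W \<subseteq> (dInt \<kappa> X ^^ i) A"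
  \<comment> \<open>A point outside the iterated closure of \<open>W\<close> lies in the iterated
    interior of \<open>X - W\<close> by duality; any other point of \<open>X\<close> lies in that of
    \<open>A\<close> by hypothesis.\<close>
  have "X = (dInt \<kappa> X ^^ i) A \<union> (dInt \<kappa> X ^^ i) (X - W)"
    using A W funpow_dInt_subset[where A = A] unfolding funpow_dInt_Diff by blast
  then have "mapH \<kappa> X A (\<lambda>x. x) n \<in> iso (dH \<kappa> (X - W) (A \<inter> (X - W)) n) (dH \<kappa> X A n)"
    using A i by (intro excision) auto
  moreover have "A \<inter> (X - W) = A - W" using A by blast
  ultimately show "mapH \<kappa> X A (\<lambda>x. x) n \<in> iso (dH \<kappa> (X - W) (A - W) n) (dH \<kappa> X A n)"
    by simp
qed (rule excision)

end
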